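(* Let $N,p,q$ be integers with $1<q\le p<\frac{4N}{e\pi}+1$, and let $A$ be a cyclically contiguous $p\times q$ submatrix of the $N\times N$ discrete Fourier matrix $F$. Then $$\operatorname{cond}(A)\;\ge\;\frac{1-\bigl(e\pi(p-1)/4N\bigr)}{2\sqrt{q}}\left(\frac{4N}{e\pi(p-1)}\right)^{q-1}.$$
   Context: The $N\times N$ discrete Fourier matrix is $F=(F_{jk})$, $F_{jk}=e^{2\pi i jk/N}$, with integer row and column indices $-N/2\le j,k<N/2$; index sets are regarded as $N$-periodic (i.e. as residues mod $N$). A cyclically contiguous $p\times q$ submatrix of $F$ is one whose row index set consists of $p$ cyclically consecutive residues mod $N$ and whose column index set consists of $q$ cyclically consecutive residues mod $N$. For a $p\times q$ matrix $A$ with singular values $\sigma_1\ge\sigma_2\ge\dots\ge\sigma_{\min(p,q)}=:\sigma_{\min}(A)$, the condition number is $\operatorname{cond}(A)=\sigma_1(A)/\sigma_{\min}(A)$. Here $e$ is Euler's number, and $e\pi(p-1)/4N$ means $\frac{e\pi(p-1)}{4N}$. *)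

theory Defs
  imports
    "HOL-Number_Theory.Cong"
    "HOL-Computational_Algebra.Fundamental_Theorem_Algebra"
    "Jordan_Normal_Form.Char_Poly"
    "Jordan_Normal_Form.Schur_Decomposition"
    "Jordan_Normal_Form.DL_Submatrix"
begin

(* The indices of an N x N matrix run over 0, ..., N - 1 in the library. Position s stands for the
   frequency index j = s - N div 2, so that j runs over the integers with - N/2 \<le> j < N/2. *)
definition dft_matrix :: "nat \<Rightarrow> complex mat" where
  "dft_matrix N = mat N N (\<lambda>(s, t).
     let j = int s - int (N div 2); k = int t - int (N div 2)
     in exp (2 * complex_of_real pi * \<i> * of_int j * of_int k / of_nat N))"

lemma dft_index_range:
  "(\<lambda>s. int s - int (N div 2)) ` {..<N} = {j. - (real N / 2) \<le> of_int j \<and> of_int j < real N / 2}"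
  (is "?f ` _ = ?R")
proof (intro equalityI subsetI)
  fix j assume "j \<in> ?f ` {..<N}"
  then obtain s where s: "s < N" "j = int s - int (N div 2)" by auto
  then have "- int N \<le> 2 * j" "2 * j < int N" by presburger+
  then have "real_of_int (- int N) \<le> of_int (2 * j)" "real_of_int (2 * j) < of_int (int N)"
    by (simp_all only: of_int_le_iff of_int_less_iff)
  then show "j \<in> ?R" by auto
next
  fix j assume "j \<in> ?R"
  then have "real_of_int (- int N) \<le> of_int (2 * j)" "real_of_int (2 * j) < of_int (int N)" by auto
  then have "- int N \<le> 2 * j" "2 * j < int N" by (simp_all only: of_int_le_iff of_int_less_iff)
  then have "0 \<le> j + int (N div 2)" "j + int (N div 2) < int N" by linarith+
  then have "j = ?f (nat (j + int (N div 2)))" "nat (j + int (N div 2)) < N" by simp_all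
  then show "j \<in> ?f ` {..<N}" by blast
qed

(* Positions and frequency indices differ by a constant shift, so being cyclically consecutive
   means the same for both. *)
definition cyclically_consecutive :: "nat \<Rightarrow> nat \<Rightarrow> nat set \<Rightarrow> bool" where
  "cyclically_consecutive N m I \<longleftrightarrow> m \<le> N \<and> (\<exists>a. I = (\<lambda>i. (a + i) mod N) ` {..<m})"

(* The library function submatrix keeps the rows and columns in increasing order of their positions;
   for an index set that wraps around this is not the cyclic order, but a permutation of rows and
   columns leaves the singular values unchanged. *)
definition cyclically_contiguous_submatrix ::
    "'a mat \<Rightarrow> nat \<Rightarrow> nat \<Rightarrow> 'a mat \<Rightarrow> bool" where
  "cyclically_contiguous_submatrix F p q A \<longleftrightarrow>
     (\<exists>I J. cyclically_consecutive (dim_row F) p I \<and> cyclically_consecutive (dim_col F) q J \<and>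
            A = submatrix F I J)"

lemma cyclically_consecutive_card:
  assumes "cyclically_consecutive N m I"
  shows "I \<subseteq> {..<N}" "card I = m"
proof -
  obtain a where a: "m \<le> N" "I = (\<lambda>i. (a + i) mod N) ` {..<m}"
    using assms by (auto simp: cyclically_consecutive_def)
  show "I \<subseteq> {..<N}" using a by auto
  have "inj_on (\<lambda>i. (a + i) mod N) {..<m}"
  proof (rule inj_onI)
    fix x y assume "x \<in> {..<m}" "y \<in> {..<m}" "(a + x) mod N = (a + y) mod N"
    then show "x = y"
      using a(1) cong_add_lcancel_nat[of a x y N] by (simp add: cong_def)
  qed
  then show "card I = m" using a(2) by (simp add: card_image)
qed

lemma cyclically_contiguous_submatrix_carrier:
  assumes "cyclically_contiguous_submatrix F p q A"
  shows "A \<in> carrier_mat p q"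
proof -
  obtain I J where IJ: "cyclically_consecutive (dim_row F) p I"
    "cyclically_consecutive (dim_col F) q J" "A = submatrix F I J"
    using assms by (auto simp: cyclically_contiguous_submatrix_def)
  have "{i. i < dim_row F \<and> i \<in> I} = I" "{j. j < dim_col F \<and> j \<in> J} = J"
    using IJ(1,2)[THEN cyclically_consecutive_card(1)] by auto
  then show ?thesis
    using IJ(1,2)[THEN cyclically_consecutive_card(2)] IJ(3) by (intro carrier_matI) (metis dim_submatrix)+
qed

(* The singular values in decreasing order, with multiplicity: the square roots of the min p q largest
   eigenvalues of the Hermitian matrix A^* A. These eigenvalues are real and nonnegative, so Re only
   changes the type. *)
definition singular_values :: "complex mat \<Rightarrow> real list" where
  "singular_values A =
     take (min (dim_row A) (dim_col A))
       (rev (sorted_list_of_multiset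
         (image_mset (\<lambda>z. sqrt (Re z)) (proots (char_poly (mat_adjoint A * A))))))"

lemma length_singular_values: "length (singular_values A) = min (dim_row A) (dim_col A)"
proof -
  have "mat_adjoint A * A \<in> carrier_mat (dim_col A) (dim_col A)"
    by (intro carrier_matI) (simp_all add: mat_adjoint_def)
  then have "degree (char_poly (mat_adjoint A * A)) = dim_col A"
    by (rule degree_monic_char_poly[THEN conjunct1])
  then have "size (proots (char_poly (mat_adjoint A * A))) = dim_col A"
    by (simp only: size_proots_complex)
  moreover have "length (sorted_list_of_multiset M) = size M" for M :: "real multiset"
    by (metis mset_sorted_list_of_multiset size_mset)
  ultimately show ?thesis
    by (simp add: singular_values_def)
qed

(* The quotient of the largest by the smallest singular value. For a matrix of deficient rank the
   division gives 0 instead of infinity. *)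
definition condition_number :: "complex mat \<Rightarrow> real" where
  "condition_number A = hd (singular_values A) / last (singular_values A)"

end

theory Submission
  imports Defs
begin

text \<open>
  Let \<open>n = q - 1\<close>. The alternating binomial vector \<open>v\<^sub>k = (-1)\<^sup>k (n choose k)\<close>, with a phase that
  centres the row indices, is nearly annihilated: by the binomial theorem the entries of \<open>A v\<close>
  have modulus \<open>|1 - cis t| ^ n\<close> with \<open>|t| \<le> \<pi> (p - 1) / N\<close>, whereas
  \<open>\<parallel>v\<parallel>\<^sup>2 = (2 n choose n) \<ge> 4 ^ n / (2 n)\<close>. A coordinate vector shows that the largest singular
  value is at least \<open>sqrt p\<close>. The resulting bound \<open>(2 N / (\<pi> (p - 1))) ^ n / sqrt (2 n)\<close> is
  stronger than the claimed one because \<open>e \<ge> 2\<close>.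
\<close>

section \<open>Real inner product and adjoint\<close>

text \<open>Passing to the real part makes the form symmetric and bilinear over the reals, so
  Rayleigh quotients are real numbers and infima of them make sense.\<close>

definition re_inner :: "complex vec \<Rightarrow> complex vec \<Rightarrow> real" where
  "re_inner x y = Re (x \<bullet>c y)"

lemma re_inner_add_left:
  assumes "x \<in> carrier_vec n" "y \<in> carrier_vec n" "z \<in> carrier_vec n"
  shows "re_inner (x + y) z = re_inner x z + re_inner y z"
  using assms by (simp add: re_inner_def add_scalar_prod_distrib[of _ n])

lemma re_inner_smult_left:
  assumes "x \<in> carrier_vec n" "y \<in> carrier_vec n"
  shows "re_inner (complex_of_real c \<cdot>\<^sub>v x) y = c * re_inner x y"
  using assms by (simp add: re_inner_def)

lemma re_inner_commute:
  assumes "x \<in> carrier_vec n" "y \<in> carrier_vec n"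
  shows "re_inner x y = re_inner y x"
  using assms by (simp add: re_inner_def scalar_prod_def algebra_simps)

lemma re_inner_add_right:
  assumes "x \<in> carrier_vec n" "y \<in> carrier_vec n" "z \<in> carrier_vec n"
  shows "re_inner z (x + y) = re_inner z x + re_inner z y"
  using re_inner_add_left[OF assms] assms by (simp add: re_inner_commute[of _ n])

lemma re_inner_smult_right:
  assumes "x \<in> carrier_vec n" "y \<in> carrier_vec n"
  shows "re_inner y (complex_of_real c \<cdot>\<^sub>v x) = c * re_inner y x"
  using re_inner_smult_left[OF assms] assms by (simp add: re_inner_commute[of _ n])

lemma re_inner_self:
  assumes "x \<in> carrier_vec n"
  shows "re_inner x x = (\<Sum>i<n. (cmod (x $ i))\<^sup>2)"
  using assms by (simp add: re_inner_def scalar_prod_def complex_mult_cnj cmod_power2 lessThan_atLeast0)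

lemma re_inner_self_nonneg: "0 \<le> re_inner x x"
  by (subst re_inner_self[OF carrier_vec_dim_vec]) (rule sum_nonneg, simp)

lemma re_inner_self_pos:
  assumes "x \<in> carrier_vec n" "x \<noteq> 0\<^sub>v n"
  shows "0 < re_inner x x"
proof -
  have "x \<bullet>c x > 0"
    using assms by (rule conjugate_square_greater_0_vec[THEN iffD2])
  then show ?thesis
    by (simp add: re_inner_def less_complex_def)
qed

lemma mat_adjoint_carrier:
  assumes "A \<in> carrier_mat m n"
  shows "mat_adjoint A \<in> carrier_mat n m"
  using assms by (intro carrier_matI) (simp_all add: mat_adjoint_def)

lemma mat_adjoint_index:
  assumes "A \<in> carrier_mat m n" "i < n" "j < m"
  shows "mat_adjoint A $$ (i, j) = cnj (A $$ (j, i))"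
  using assms by (simp add: mat_adjoint_def mat_of_rows_def)

text \<open>Both sides are the real part of one double sum, summed in the two possible
  orders.\<close>

lemma re_inner_mat_adjoint:
  assumes A: "A \<in> carrier_mat m n" and x: "x \<in> carrier_vec m" and y: "y \<in> carrier_vec n"
  shows "re_inner (mat_adjoint A *\<^sub>v x) y = re_inner x (A *\<^sub>v y)"
proof -
  note adj = mat_adjoint_carrier[OF A]
  have Ax: "(mat_adjoint A *\<^sub>v x) $ i = (\<Sum>j<m. cnj (A $$ (j, i)) * x $ j)" if "i < n" for i
    using that A x adj by (simp add: scalar_prod_def lessThan_atLeast0 mat_adjoint_index[OF A])
  have Ay: "(A *\<^sub>v y) $ j = (\<Sum>i<n. A $$ (j, i) * y $ i)" if "j < m" for j
    using that A y by (simp add: scalar_prod_def lessThan_atLeast0)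
  have "(mat_adjoint A *\<^sub>v x) \<bullet>c y = (\<Sum>i<n. (mat_adjoint A *\<^sub>v x) $ i * cnj (y $ i))"
    using y by (simp add: scalar_prod_def lessThan_atLeast0)
  also have "\<dots> = (\<Sum>i<n. \<Sum>j<m. cnj (A $$ (j, i)) * x $ j * cnj (y $ i))"
    by (simp add: Ax sum_distrib_right)
  also have "\<dots> = (\<Sum>j<m. \<Sum>i<n. cnj (A $$ (j, i)) * x $ j * cnj (y $ i))"
    by (rule sum.swap)
  also have "\<dots> = (\<Sum>j<m. x $ j * cnj ((A *\<^sub>v y) $ j))"
    by (simp add: Ay sum_distrib_left mult_ac)
  also have "\<dots> = x \<bullet>c (A *\<^sub>v y)"
    using A by (simp add: scalar_prod_def lessThan_atLeast0)
  finally show ?thesis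
    by (simp add: re_inner_def)
qed

section \<open>Bounds for quadratic forms\<close>

text \<open>A crude substitute for the operator norm: each entry of \<open>A x\<close> is at most
  its absolute row sum \<open>r i\<close> times the norm of \<open>x\<close>. The summand 1 in
  \<open>C\<close> makes the constant strictly positive.\<close>

lemma mat_mult_vec_bound:
  assumes A: "A \<in> carrier_mat m n"
  obtains C where "C > 0"
    "\<And>x :: complex vec. x \<in> carrier_vec n \<Longrightarrow> re_inner (A *\<^sub>v x) (A *\<^sub>v x) \<le> C * re_inner x x"
proof
  define r where "r i = (\<Sum>j<n. cmod (A $$ (i, j)))" for i
  define C where "C = 1 + (\<Sum>i<m. (r i)\<^sup>2)"
  have "0 \<le> (\<Sum>i<m. (r i)\<^sup>2)"
    by (rule sum_nonneg) simp
  then show "C > 0"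
    by (simp add: C_def)
  fix x :: "complex vec" assume x: "x \<in> carrier_vec n"
  have "(cmod ((A *\<^sub>v x) $ i))\<^sup>2 \<le> (r i)\<^sup>2 * re_inner x x" if i: "i < m" for i
  proof -
    have le: "cmod (x $ j) \<le> sqrt (re_inner x x)" if "j < n" for j
      using that member_le_sum[of j "{..<n}" "\<lambda>i. (cmod (x $ i))\<^sup>2"]
      by (intro real_le_rsqrt) (simp add: re_inner_self[OF x])
    have "cmod ((A *\<^sub>v x) $ i) = cmod (\<Sum>j<n. A $$ (i, j) * x $ j)"
      using A x i by (simp add: scalar_prod_def lessThan_atLeast0)
    also have "\<dots> \<le> (\<Sum>j<n. cmod (A $$ (i, j)) * sqrt (re_inner x x))"
      using le by (intro sum_norm_le) (auto simp: norm_mult intro!: mult_left_mono)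
    also have "\<dots> = r i * sqrt (re_inner x x)"
      by (simp add: r_def sum_distrib_right)
    finally have "(cmod ((A *\<^sub>v x) $ i))\<^sup>2 \<le> (r i * sqrt (re_inner x x))\<^sup>2"
      by (rule power_mono) simp
    then show ?thesis
      by (simp add: power_mult_distrib re_inner_self_nonneg)
  qed
  then have "re_inner (A *\<^sub>v x) (A *\<^sub>v x) \<le> (\<Sum>i<m. (r i)\<^sup>2 * re_inner x x)"
    using A x by (subst re_inner_self[of _ m]) (auto intro!: sum_mono)
  also have "\<dots> \<le> C * re_inner x x"
    using re_inner_self_nonneg[of x] by (simp add: C_def ring_distribs flip: sum_distrib_right)
  finally show "re_inner (A *\<^sub>v x) (A *\<^sub>v x) \<le> C * re_inner x x" .
qed

text \<open>Squared norms are nonnegative; expanding those of \<open>x + y\<close> and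
  \<open>x - y\<close> gives the two signs of the absolute value.\<close>

lemma re_inner_le_half:
  assumes "x \<in> carrier_vec n" "y \<in> carrier_vec n"
  shows "2 * \<bar>re_inner x y\<bar> \<le> re_inner x x + re_inner y y"
proof -
  have "0 \<le> re_inner x x + 2 * c * re_inner x y + c\<^sup>2 * re_inner y y" for c
    using re_inner_self_nonneg[of "x + complex_of_real c \<cdot>\<^sub>v y"] assms
    by (simp add: re_inner_add_left[of _ n] re_inner_add_right[of _ n] re_inner_smult_left[of _ n]
        re_inner_smult_right[of _ n] re_inner_commute[of y n x] power2_eq_square algebra_simps)
  from this[of 1] this[of "- 1"] show ?thesis
    by simp
qed

text \<open>
  Expanding \<open>0 \<le> \<langle>K (x + t y), x + t y\<rangle>\<close> with \<open>y = K x\<close> and a suitable \<open>t < 0\<close> gives the bound.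
\<close>

lemma psd_mult_vec_bound:
  assumes K: "K \<in> carrier_mat n n"
    and sym: "\<And>x y. x \<in> carrier_vec n \<Longrightarrow> y \<in> carrier_vec n \<Longrightarrow>
      re_inner (K *\<^sub>v x) y = re_inner x (K *\<^sub>v y)"
    and psd: "\<And>x. x \<in> carrier_vec n \<Longrightarrow> 0 \<le> re_inner (K *\<^sub>v x) x"
  obtains C where "C > 0"
    "\<And>x :: complex vec. x \<in> carrier_vec n \<Longrightarrow> re_inner (K *\<^sub>v x) (K *\<^sub>v x) \<le> C * re_inner (K *\<^sub>v x) x"
proof -
  obtain D where D: "D > 0"
    "\<And>x :: complex vec. x \<in> carrier_vec n \<Longrightarrow> re_inner (K *\<^sub>v x) (K *\<^sub>v x) \<le> D * re_inner x x"
    using mat_mult_vec_bound[OF K] by metis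
  \<comment> \<open>Chosen so that \<open>re_inner (K y) y\<close> is at most
    \<open>C * re_inner y y\<close>: twice the left side is bounded by the squared norms of
    \<open>K y\<close> and \<open>y\<close>, hence by \<open>D + 1\<close> times that of
    \<open>y\<close>.\<close>
  define C where "C = (D + 1) / 2"
  have C: "C > 0" using D by (simp add: C_def)
  show ?thesis
  proof
    show "C > 0" by fact
    fix x :: "complex vec" assume x: "x \<in> carrier_vec n"
    define y where "y = K *\<^sub>v x"
    \<comment> \<open>This value minimises \<open>2 * t + C * t^2\<close>, the coefficient of
      \<open>re_inner y y\<close> in the expansion; the minimum is \<open>- 1 / C\<close>.\<close>
    define t where "t = - 1 / C"
    have y: "y \<in> carrier_vec n" and Ky: "K *\<^sub>v y \<in> carrier_vec n"
      using K x by (auto simp: y_def)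
    have "2 * re_inner (K *\<^sub>v y) y \<le> (D + 1) * re_inner y y"
      using re_inner_le_half[OF Ky y] D(2)[OF y] by (simp add: algebra_simps)
    then have b: "re_inner (K *\<^sub>v y) y \<le> C * re_inner y y"
      by (simp add: C_def)
    have "0 \<le> re_inner (K *\<^sub>v (x + complex_of_real t \<cdot>\<^sub>v y)) (x + complex_of_real t \<cdot>\<^sub>v y)"
      using x y by (intro psd) simp
    also have "\<dots> = re_inner y x + 2 * t * re_inner y y + t\<^sup>2 * re_inner (K *\<^sub>v y) y"
    proof -
      have "K *\<^sub>v (x + complex_of_real t \<cdot>\<^sub>v y) = y + complex_of_real t \<cdot>\<^sub>v (K *\<^sub>v y)"
        using K x y by (simp add: mult_add_distrib_mat_vec[of _ n n] mult_mat_vec[of _ n n] y_def)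
      moreover have "re_inner (K *\<^sub>v y) x = re_inner y y"
        using sym[OF y x] by (simp add: y_def)
      ultimately show ?thesis
        using x y Ky
        by (simp add: re_inner_add_left[of _ n] re_inner_add_right[of _ n] re_inner_smult_left[of _ n]
            re_inner_smult_right[of _ n] power2_eq_square algebra_simps)
    qed
    also have "\<dots> \<le> re_inner y x + 2 * t * re_inner y y + t\<^sup>2 * (C * re_inner y y)"
      using b by (simp add: mult_left_mono)
    also have "\<dots> = re_inner y x - re_inner y y / C"
      using C by (simp add: t_def power2_eq_square field_simps)
    finally show "re_inner (K *\<^sub>v x) (K *\<^sub>v x) \<le> C * re_inner (K *\<^sub>v x) x"
      using C by (simp add: y_def field_simps)
  qed
qed

section \<open>Extreme eigenvalues through the Rayleigh quotient\<close>

lemma char_matrix_mult_vec: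
  fixes H :: "'a :: field mat"
  assumes "H \<in> carrier_mat n n" "x \<in> carrier_vec n"
  shows "char_matrix H e *\<^sub>v x = H *\<^sub>v x + (- e) \<cdot>\<^sub>v x"
proof -
  have "((- e) \<cdot>\<^sub>m 1\<^sub>m n) *\<^sub>v x = (- e) \<cdot>\<^sub>v x"
    using assms by (intro eq_vecI) (auto simp: row_smult)
  then show ?thesis
    using assms by (simp add: char_matrix_def add_mult_distrib_mat_vec[of _ n n])
qed

text \<open>
  No compactness is needed: let \<open>\<mu>\<close> be the infimum of the Rayleigh quotient. If \<open>K = H - \<mu>\<close> were
  invertible, then \<open>\<parallel>x\<parallel>\<^sup>2 \<le> B \<parallel>K x\<parallel>\<^sup>2 \<le> B C \<langle>K x, x\<rangle>\<close>, so \<open>\<mu>\<close> could be increased.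
\<close>

lemma least_eigenvalue_rayleigh:
  assumes H: "H \<in> carrier_mat n n" and n: "n > 0"
    and sym: "\<And>x y. x \<in> carrier_vec n \<Longrightarrow> y \<in> carrier_vec n \<Longrightarrow>
      re_inner (H *\<^sub>v x) y = re_inner x (H *\<^sub>v y)"
  obtains \<mu> where "eigenvalue H (complex_of_real \<mu>)"
    "\<And>x. x \<in> carrier_vec n \<Longrightarrow> \<mu> * re_inner x x \<le> re_inner (H *\<^sub>v x) x"
proof -
  define X where "X = {x :: complex vec. x \<in> carrier_vec n \<and> x \<noteq> 0\<^sub>v n}"
  define R where "R x = re_inner (H *\<^sub>v x) x / re_inner x x" for x
  define \<mu> where "\<mu> = Inf (R ` X)"
  have pos: "0 < re_inner x x" if "x \<in> X" for x
    using that re_inner_self_pos by (auto simp: X_def)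
  have "unit_vec n 0 \<in> X"
    using n by (simp add: X_def)
  then have ne: "R ` X \<noteq> {}" by blast
  obtain D where D: "D > 0"
    "\<And>x :: complex vec. x \<in> carrier_vec n \<Longrightarrow> re_inner (H *\<^sub>v x) (H *\<^sub>v x) \<le> D * re_inner x x"
    using mat_mult_vec_bound[OF H] by metis
  \<comment> \<open>A lower bound is needed before \<open>Inf\<close> can be used as an infimum; it
    comes from the bound on \<open>H x\<close> and \<open>re_inner_le_half\<close>.\<close>
  have "- (D + 1) / 2 \<le> R x" if x: "x \<in> X" for x
  proof -
    have xc: "x \<in> carrier_vec n" "H *\<^sub>v x \<in> carrier_vec n" using x H by (auto simp: X_def)
    have "- (D + 1) / 2 * re_inner x x \<le> re_inner (H *\<^sub>v x) x"
      using re_inner_le_half[OF xc(2,1)] D(2)[OF xc(1)] by (simp add: algebra_simps)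
    then show ?thesis
      using pos[OF x] by (simp add: R_def pos_le_divide_eq)
  qed
  then have bdd: "bdd_below (R ` X)"
    by (intro bdd_belowI[of _ "- (D + 1) / 2"]) blast
  have lower: "\<mu> * re_inner x x \<le> re_inner (H *\<^sub>v x) x" if x: "x \<in> carrier_vec n" for x
  proof (cases "x = 0\<^sub>v n")
    case True
    then show ?thesis using H by (simp add: re_inner_def)
  next
    case False
    then have xX: "x \<in> X" using x by (simp add: X_def)
    then have "\<mu> \<le> R x"
      unfolding \<mu>_def using bdd by (intro cInf_lower) auto
    then show ?thesis
      using pos[OF xX] by (simp add: R_def pos_le_divide_eq)
  qed
  have "eigenvalue H (complex_of_real \<mu>)"
  proof (rule ccontr)
    assume no: "\<not> eigenvalue H (complex_of_real \<mu>)"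
    define K where "K = char_matrix H (complex_of_real \<mu>)"
    have K: "K \<in> carrier_mat n n" using H by (simp add: K_def)
    have Kx: "K *\<^sub>v x = H *\<^sub>v x + complex_of_real (- \<mu>) \<cdot>\<^sub>v x" if "x \<in> carrier_vec n" for x
      using char_matrix_mult_vec[OF H that] by (simp add: K_def)
    have Kxy: "re_inner (K *\<^sub>v x) y = re_inner (H *\<^sub>v x) y - \<mu> * re_inner x y"
      if "x \<in> carrier_vec n" "y \<in> carrier_vec n" for x y
      using that H
      by (simp only: Kx) (simp add: re_inner_add_left[of _ n] re_inner_smult_left[of _ n] del: of_real_minus)
    have "re_inner (K *\<^sub>v x) y = re_inner x (K *\<^sub>v y)"
      if "x \<in> carrier_vec n" "y \<in> carrier_vec n" for x y
      using that K H Kxy[of x y] Kxy[of y x] sym[of x y]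
      by (simp add: re_inner_commute[of x n])
    moreover have "0 \<le> re_inner (K *\<^sub>v x) x" if "x \<in> carrier_vec n" for x
      using lower[OF that] Kxy[OF that that] by simp
    ultimately obtain C where C: "C > 0"
      "\<And>x :: complex vec. x \<in> carrier_vec n \<Longrightarrow> re_inner (K *\<^sub>v x) (K *\<^sub>v x) \<le> C * re_inner (K *\<^sub>v x) x"
      using psd_mult_vec_bound[OF K] by metis
    have "det K \<noteq> 0"
      using no eigenvalue_det[OF H] by (simp add: K_def)
    then obtain M where M: "M \<in> carrier_mat n n" "M * K = 1\<^sub>m n"
      using det_non_zero_imp_unit[OF K] by (auto simp: Units_def ring_mat_def)
    obtain B where B: "B > 0"
      "\<And>x :: complex vec. x \<in> carrier_vec n \<Longrightarrow> re_inner (M *\<^sub>v x) (M *\<^sub>v x) \<le> B * re_inner x x"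
      using mat_mult_vec_bound[OF M(1)] by metis
    have "\<mu> + 1 / (B * C) \<le> R x" if x: "x \<in> X" for x
    proof -
      have xc: "x \<in> carrier_vec n" using x by (simp add: X_def)
      have "M *\<^sub>v (K *\<^sub>v x) = x"
        using M K xc by (simp flip: assoc_mult_mat_vec)
      then have "re_inner x x \<le> B * re_inner (K *\<^sub>v x) (K *\<^sub>v x)"
        using B(2)[of "K *\<^sub>v x"] K xc by simp
      also have "\<dots> \<le> B * (C * re_inner (K *\<^sub>v x) x)"
        using B(1) C(2)[OF xc] by simp
      finally have "re_inner x x / (B * C) \<le> re_inner (H *\<^sub>v x) x - \<mu> * re_inner x x"
        using B(1) C(1) Kxy[OF xc xc] by (simp add: pos_divide_le_eq mult_ac)
      then have "(\<mu> + 1 / (B * C)) * re_inner x x \<le> re_inner (H *\<^sub>v x) x"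
        by (simp add: algebra_simps)
      then show ?thesis
        using pos[OF x] by (simp add: R_def pos_le_divide_eq)
    qed
    then have "\<mu> + 1 / (B * C) \<le> \<mu>"
      using ne unfolding \<mu>_def by (intro cInf_greatest) auto
    then show False
      using B(1) C(1) by (simp add: divide_le_0_iff mult_le_0_iff)
  qed
  with lower show thesis
    using that by blast
qed

text \<open>Apply the previous result to \<open>- H\<close> and change the sign of the
  eigenvalue.\<close>

lemma greatest_eigenvalue_rayleigh:
  assumes H: "H \<in> carrier_mat n n" and n: "n > 0"
    and sym: "\<And>x y. x \<in> carrier_vec n \<Longrightarrow> y \<in> carrier_vec n \<Longrightarrow>
      re_inner (H *\<^sub>v x) y = re_inner x (H *\<^sub>v y)"
  obtains \<mu> where "eigenvalue H (complex_of_real \<mu>)"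
    "\<And>x :: complex vec. x \<in> carrier_vec n \<Longrightarrow> re_inner (H *\<^sub>v x) x \<le> \<mu> * re_inner x x"
proof -
  have neg: "(- H) *\<^sub>v x = complex_of_real (- 1) \<cdot>\<^sub>v (H *\<^sub>v x)" if "x \<in> carrier_vec n" for x
    using H that by (intro eq_vecI) (auto simp: scalar_prod_def sum_negf)
  have H': "- H \<in> carrier_mat n n" using H by simp
  have l: "re_inner ((- H) *\<^sub>v x) y = - re_inner (H *\<^sub>v x) y"
    if "x \<in> carrier_vec n" "y \<in> carrier_vec n" for x y
    using that H by (simp only: neg) (simp add: re_inner_smult_left[of _ n] del: of_real_minus)
  have r: "re_inner x ((- H) *\<^sub>v y) = - re_inner x (H *\<^sub>v y)"
    if "x \<in> carrier_vec n" "y \<in> carrier_vec n" for x y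
    using that H by (simp only: neg) (simp add: re_inner_smult_right[of _ n] del: of_real_minus)
  obtain \<mu> where \<mu>: "eigenvalue (- H) (complex_of_real \<mu>)"
    "\<And>x. x \<in> carrier_vec n \<Longrightarrow> \<mu> * re_inner x x \<le> re_inner ((- H) *\<^sub>v x) x"
    using least_eigenvalue_rayleigh[OF H' n] sym l r by metis
  obtain v where v: "v \<in> carrier_vec n" "v \<noteq> 0\<^sub>v n" "(- H) *\<^sub>v v = complex_of_real \<mu> \<cdot>\<^sub>v v"
    using \<mu>(1) H by (auto simp: eigenvalue_def eigenvector_def)
  have "H *\<^sub>v v = complex_of_real (- 1) \<cdot>\<^sub>v ((- H) *\<^sub>v v)"
    using H v(1) by (simp only: neg) (auto intro!: eq_vecI)
  then have "H *\<^sub>v v = complex_of_real (- \<mu>) \<cdot>\<^sub>v v"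
    using v by (simp add: smult_smult_assoc)
  then have "eigenvalue H (complex_of_real (- \<mu>))"
    using v H by (auto simp: eigenvalue_def eigenvector_def)
  moreover have "re_inner (H *\<^sub>v x) x \<le> (- \<mu>) * re_inner x x" if "x \<in> carrier_vec n" for x
    using \<mu>(2)[OF that] l[OF that that] by simp
  ultimately show thesis
    using that by blast
qed

section \<open>Singular values through the Gram matrix\<close>

context
  fixes A :: "complex mat" and p q :: nat
  assumes A: "A \<in> carrier_mat p q" and q: "0 < q" "q \<le> p"
begin

lemma gram_carrier: "mat_adjoint A * A \<in> carrier_mat q q"
  using mat_adjoint_carrier[OF A] A by simp

text \<open>Moving the adjoint across turns the Rayleigh quotient of the Gram matrix into the ratio
  of the squared norms of \<open>A x\<close> and \<open>x\<close>.\<close>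

lemma re_inner_gram:
  assumes "x \<in> carrier_vec q" "y \<in> carrier_vec q"
  shows "re_inner ((mat_adjoint A * A) *\<^sub>v x) y = re_inner (A *\<^sub>v x) (A *\<^sub>v y)"
  using assms A mat_adjoint_carrier[OF A] re_inner_mat_adjoint[OF A _ assms(2), of "A *\<^sub>v x"]
  by (simp add: assoc_mult_mat_vec[of _ q p])

lemma re_inner_gram_symmetric:
  assumes "x \<in> carrier_vec q" "y \<in> carrier_vec q"
  shows "re_inner ((mat_adjoint A * A) *\<^sub>v x) y = re_inner x ((mat_adjoint A * A) *\<^sub>v y)"
  using re_inner_gram[OF assms] re_inner_gram[OF assms(2,1)] assms A gram_carrier
  by (simp add: re_inner_commute[of x q] re_inner_commute[of "A *\<^sub>v x" p])

lemma gram_eigenvalues: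
  "set_mset (proots (char_poly (mat_adjoint A * A))) = {z. eigenvalue (mat_adjoint A * A) z}"
proof -
  have "char_poly (mat_adjoint A * A) \<noteq> 0"
    using degree_monic_char_poly[OF gram_carrier] by auto
  then show ?thesis
    by (simp add: eigenvalue_root_char_poly[OF gram_carrier])
qed

lemma singular_values_gram:
  shows "set (singular_values A) = (\<lambda>z. sqrt (Re z)) ` {z. eigenvalue (mat_adjoint A * A) z}"
    and "sorted (rev (singular_values A))"
    and "singular_values A \<noteq> []"
proof -
  define L where "L = sorted_list_of_multiset
         (image_mset (\<lambda>z. sqrt (Re z)) (proots (char_poly (mat_adjoint A * A))))"
  have "length L = size (proots (char_poly (mat_adjoint A * A)))"
    unfolding L_def by (metis mset_sorted_list_of_multiset size_mset size_image_mset)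
  also have "\<dots> = q"
    using degree_monic_char_poly[OF gram_carrier] by (simp add: size_proots_complex)
  finally have len: "length L = q" .
  \<comment> \<open>Since \<open>q\<close> is at most \<open>p\<close>, the \<open>take\<close> in
    \<open>singular_values\<close> drops nothing, and all \<open>q\<close> eigenvalues
    occur.\<close>
  then have sv: "singular_values A = rev L"
    using A q by (simp add: singular_values_def L_def)
  show "set (singular_values A) = (\<lambda>z. sqrt (Re z)) ` {z. eigenvalue (mat_adjoint A * A) z}"
    by (simp add: sv L_def gram_eigenvalues)
  show "sorted (rev (singular_values A))"
    by (simp add: sv L_def)
  show "singular_values A \<noteq> []"
    using len q by (auto simp: sv)
qed

lemma last_le_singular_value:
  assumes "s \<in> set (singular_values A)"
  shows "last (singular_values A) \<le> s"
proof -
  from assms have "s \<in> set (rev (singular_values A))" by simp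
  then have "hd (rev (singular_values A)) \<le> s"
    using singular_values_gram(2) by (cases "rev (singular_values A)") auto
  then show ?thesis
    by (simp only: hd_rev)
qed

lemma singular_value_le_hd:
  assumes "s \<in> set (singular_values A)"
  shows "s \<le> hd (singular_values A)"
  using assms singular_values_gram(2,3) by (cases "singular_values A") (auto simp: sorted_append)

text \<open>The least Gram eigenvalue is at most the Rayleigh quotient of any test vector, and its
  root is in the list, hence not below the last entry.\<close>

lemma last_singular_value_bound:
  assumes x: "x \<in> carrier_vec q"
    and le: "re_inner (A *\<^sub>v x) (A *\<^sub>v x) \<le> s\<^sup>2 * re_inner x x" and "x \<noteq> 0\<^sub>v q" and s: "0 \<le> s"
  shows "last (singular_values A) \<le> s"
proof -
  obtain \<mu> where \<mu>: "eigenvalue (mat_adjoint A * A) (complex_of_real \<mu>)"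
    "\<And>x. x \<in> carrier_vec q \<Longrightarrow> \<mu> * re_inner x x \<le> re_inner ((mat_adjoint A * A) *\<^sub>v x) x"
    using least_eigenvalue_rayleigh[OF gram_carrier q(1) re_inner_gram_symmetric] by metis
  have "\<mu> * re_inner x x \<le> s\<^sup>2 * re_inner x x"
    using \<mu>(2)[OF x] re_inner_gram[OF x x] le by simp
  then have "\<mu> \<le> s\<^sup>2"
    using re_inner_self_pos[OF x \<open>x \<noteq> 0\<^sub>v q\<close>] by simp
  then have "sqrt \<mu> \<le> s"
    using s by (simp add: real_le_lsqrt)
  moreover have "sqrt \<mu> \<in> set (singular_values A)"
    using \<mu>(1) by (force simp: singular_values_gram(1))
  ultimately show ?thesis
    using last_le_singular_value by force
qed

text \<open>Dual to the preceding bound: the greatest Gram eigenvalue dominates the Rayleigh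
  quotient of any test vector.\<close>

lemma hd_singular_value_bound:
  assumes x: "x \<in> carrier_vec q"
    and le: "S\<^sup>2 * re_inner x x \<le> re_inner (A *\<^sub>v x) (A *\<^sub>v x)" and "x \<noteq> 0\<^sub>v q"
  shows "S \<le> hd (singular_values A)"
proof -
  obtain \<mu> where \<mu>: "eigenvalue (mat_adjoint A * A) (complex_of_real \<mu>)"
    "\<And>x. x \<in> carrier_vec q \<Longrightarrow> re_inner ((mat_adjoint A * A) *\<^sub>v x) x \<le> \<mu> * re_inner x x"
    using greatest_eigenvalue_rayleigh[OF gram_carrier q(1) re_inner_gram_symmetric] by metis
  have "S\<^sup>2 * re_inner x x \<le> \<mu> * re_inner x x"
    using \<mu>(2)[OF x] re_inner_gram[OF x x] le by simp
  then have "S\<^sup>2 \<le> \<mu>"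
    using re_inner_self_pos[OF x \<open>x \<noteq> 0\<^sub>v q\<close>] by simp
  then have "S \<le> sqrt \<mu>"
    by (rule real_le_rsqrt)
  moreover have "sqrt \<mu> \<in> set (singular_values A)"
    using \<mu>(1) by (force simp: singular_values_gram(1))
  ultimately show ?thesis
    using singular_value_le_hd by force
qed

text \<open>Without injectivity the division in \<^const>\<open>condition_number\<close> would give the junk value 0.\<close>

lemma last_singular_value_pos:
  assumes inj: "\<And>x. x \<in> carrier_vec q \<Longrightarrow> A *\<^sub>v x = 0\<^sub>v p \<Longrightarrow> x = 0\<^sub>v q"
  shows "0 < last (singular_values A)"
proof -
  have "last (singular_values A) \<in> set (singular_values A)"
    using singular_values_gram(3) by simp
  then obtain z where z: "last (singular_values A) = sqrt (Re z)" "eigenvalue (mat_adjoint A * A) z"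
    by (auto simp: singular_values_gram(1))
  obtain v where v: "v \<in> carrier_vec q" "v \<noteq> 0\<^sub>v q" "(mat_adjoint A * A) *\<^sub>v v = z \<cdot>\<^sub>v v"
    using z(2) gram_carrier by (auto simp: eigenvalue_def eigenvector_def)
  have "z * (v \<bullet>c v) = (z \<cdot>\<^sub>v v) \<bullet>c v"
    using v(1) by simp
  \<comment> \<open>As \<open>v \<bullet>c v\<close> is real, taking real parts of the eigenvalue
    equation isolates \<open>Re z\<close>.\<close>
  moreover have "Im (v \<bullet>c v) = 0"
    using conjugate_square_ge_0_vec[of v] by (simp add: less_eq_complex_def)
  ultimately have "Re z * re_inner v v = re_inner (A *\<^sub>v v) (A *\<^sub>v v)"
    using re_inner_gram[OF v(1) v(1)] by (simp add: v(3) re_inner_def)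
  moreover have "0 < re_inner (A *\<^sub>v v) (A *\<^sub>v v)"
    using inj[OF v(1)] v A by (intro re_inner_self_pos[of _ p]) auto
  ultimately have "0 < Re z"
    using re_inner_self_pos[OF v(1,2)] by (metis zero_less_mult_pos2)
  then show ?thesis
    by (simp add: z(1))
qed

text \<open>The vector \<open>x\<close> bounds the smallest singular value from above,
  \<open>y\<close> bounds the largest from below, and injectivity keeps the denominator positive, so
  that the quotients compare.\<close>

lemma condition_number_ge:
  assumes inj: "\<And>x. x \<in> carrier_vec q \<Longrightarrow> A *\<^sub>v x = 0\<^sub>v p \<Longrightarrow> x = 0\<^sub>v q"
    and x: "x \<in> carrier_vec q" "x \<noteq> 0\<^sub>v q" "re_inner (A *\<^sub>v x) (A *\<^sub>v x) \<le> s\<^sup>2 * re_inner x x"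
    and y: "y \<in> carrier_vec q" "y \<noteq> 0\<^sub>v q" "S\<^sup>2 * re_inner y y \<le> re_inner (A *\<^sub>v y) (A *\<^sub>v y)"
    and nonneg: "0 \<le> s" "0 \<le> S"
  shows "S / s \<le> condition_number A"
proof -
  have "S \<le> hd (singular_values A)"
    using y by (intro hd_singular_value_bound)
  moreover have "last (singular_values A) \<le> s"
    using x nonneg(1) by (intro last_singular_value_bound)
  moreover have "0 < last (singular_values A)"
    using inj by (rule last_singular_value_pos)
  ultimately show ?thesis
    unfolding condition_number_def using nonneg(2) by (intro frac_le) linarith+
qed

end

section \<open>Roots of unity and cyclic index sets\<close>

lemma cis_of_int_cong:
  assumes "[a = b] (mod int N)" "N > 0"
  shows "cis (2 * pi * of_int a / of_nat N) = cis (2 * pi * of_int b / of_nat N)"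
proof -
  obtain m where "a = b + int N * m"
    using assms(1) by (metis cong_iff_lin cong_sym)
  then have "2 * pi * of_int a / of_nat N = 2 * pi * of_int b / of_nat N + of_int m * (2 * pi)"
    using assms(2) by (simp add: field_simps)
  moreover have "cis (of_int m * (2 * pi)) = 1"
    by (metis cis_multiple_2pi Ints_of_int mult.commute)
  ultimately show ?thesis
    by (simp flip: cis_mult)
qed

text \<open>The chord has length \<open>2 * \<bar>sin (t / 2)\<bar>\<close>, at most the arc
  length.\<close>

lemma cis_one_minus_bound: "cmod (1 - cis t) \<le> \<bar>t\<bar>"
proof -
  have "(cmod (1 - cis t))\<^sup>2 = (1 - cos t)\<^sup>2 + (sin t)\<^sup>2"
    by (simp add: cmod_power2)
  also have "\<dots> = 2 - 2 * cos (2 * (t / 2))"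
    by (simp add: sin_squared_eq power2_eq_square algebra_simps)
  also have "\<dots> = (2 * sin (t / 2))\<^sup>2"
    unfolding cos_double_sin by (simp add: power_mult_distrib)
  also have "\<dots> \<le> t\<^sup>2"
    using abs_sin_x_le_abs_x[of "t / 2"] by (simp only: abs_le_square_iff[symmetric])
  finally show ?thesis
    by (simp add: abs_le_square_iff[symmetric])
qed

lemma pick_bij_betw:
  assumes "finite I"
  shows "bij_betw (pick I) {..<card I} I"
proof -
  have inj: "inj_on (pick I) {..<card I}"
    by (rule inj_onI) (metis card_pick_le lessThan_iff)
  moreover have "pick I ` {..<card I} \<subseteq> I"
    using pick_in_set_le by auto
  ultimately have "pick I ` {..<card I} = I"
    using assms by (intro card_subset_eq) (simp_all add: card_image)
  with inj show ?thesis
    by (simp add: bij_betw_def)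
qed

text \<open>\<open>pick\<close> lists \<open>I\<close> in increasing order, which differs from the
  cyclic order when \<open>I\<close> wraps around; the permutation \<open>f\<close> translates
  between the two.\<close>

lemma cyclically_consecutive_pick:
  assumes I: "cyclically_consecutive N m I"
  obtains a f where "bij_betw f {..<m} {..<m}" "\<And>i. i < m \<Longrightarrow> pick I (f i) = (a + i) mod N"
proof -
  note card = cyclically_consecutive_card[OF I]
  obtain a where a: "I = (\<lambda>i. (a + i) mod N) ` {..<m}"
    using I by (auto simp: cyclically_consecutive_def)
  have pick: "bij_betw (pick I) {..<m} I"
    using pick_bij_betw[of I] card finite_subset by auto
  have "bij_betw (\<lambda>i. (a + i) mod N) {..<m} I"
    using a card(2) by (simp add: bij_betw_def eq_card_imp_inj_on)
  then have "bij_betw (inv_into {..<m} (pick I) \<circ> (\<lambda>i. (a + i) mod N)) {..<m} {..<m}"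
    by (rule bij_betw_trans) (rule bij_betw_inv_into[OF pick])
  moreover have "pick I ((inv_into {..<m} (pick I) \<circ> (\<lambda>i. (a + i) mod N)) i) = (a + i) mod N"
    if "i < m" for i
    using that pick a by (auto simp: bij_betw_def intro!: f_inv_into_f)
  ultimately show thesis
    using that by blast
qed

lemma dft_matrix_index:
  assumes "N > 0"
  shows "dft_matrix N $$ (a mod N, b mod N) =
    cis (2 * pi * of_int ((int a - int (N div 2)) * (int b - int (N div 2))) / of_nat N)"
proof -
  have "dft_matrix N $$ (a mod N, b mod N) =
    cis (2 * pi * of_int ((int (a mod N) - int (N div 2)) * (int (b mod N) - int (N div 2))) / of_nat N)"
    using assms by (simp add: dft_matrix_def Let_def cis_conv_exp algebra_simps)
  also have "\<dots> = cis (2 * pi * of_int ((int a - int (N div 2)) * (int b - int (N div 2))) / of_nat N)"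
    using assms by (intro cis_of_int_cong cong_mult cong_diff) (simp_all add: cong_def zmod_int)
  finally show ?thesis .
qed

text \<open>In cyclic order the wrap-around disappears: the starting positions and the shift by
  \<open>N div 2\<close> are absorbed in the integer offsets \<alpha> and \<beta>.\<close>

lemma dft_submatrix_cyclic_order:
  assumes A: "cyclically_contiguous_submatrix (dft_matrix N) p q A" and N: "N > 0"
  obtains \<alpha> \<beta> :: int and f g where "bij_betw f {..<p} {..<p}" "bij_betw g {..<q} {..<q}"
    "\<And>i k. i < p \<Longrightarrow> k < q \<Longrightarrow>
      A $$ (f i, g k) = cis (2 * pi * of_int ((\<alpha> + int i) * (\<beta> + int k)) / of_nat N)"
proof -
  have dim: "dim_row (dft_matrix N) = N" "dim_col (dft_matrix N) = N"
    by (simp_all add: dft_matrix_def)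
  obtain I J where I: "cyclically_consecutive N p I" and J: "cyclically_consecutive N q J"
    and sub: "A = submatrix (dft_matrix N) I J"
    using A by (auto simp: cyclically_contiguous_submatrix_def dim)
  obtain a f where f: "bij_betw f {..<p} {..<p}" "\<And>i. i < p \<Longrightarrow> pick I (f i) = (a + i) mod N"
    using cyclically_consecutive_pick[OF I] by blast
  obtain b g where g: "bij_betw g {..<q} {..<q}" "\<And>k. k < q \<Longrightarrow> pick J (g k) = (b + k) mod N"
    using cyclically_consecutive_pick[OF J] by blast
  have "{i. i < N \<and> i \<in> I} = I" "{j. j < N \<and> j \<in> J} = J"
    using I J cyclically_consecutive_card(1) by blast+
  then have card: "card {i. i < N \<and> i \<in> I} = p" "card {j. j < N \<and> j \<in> J} = q"
    using I J cyclically_consecutive_card(2) by simp_all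
  have "A $$ (f i, g k) = cis (2 * pi * of_int ((int a - int (N div 2) + int i) *
      (int b - int (N div 2) + int k)) / of_nat N)" if "i < p" "k < q" for i k
  proof -
    have "f i < p" "g k < q"
      using that f(1) g(1) by (auto simp: bij_betw_def)
    then have "A $$ (f i, g k) = dft_matrix N $$ ((a + i) mod N, (b + k) mod N)"
      using that f(2) g(2) by (simp add: sub submatrix_index dim card)
    then show ?thesis
      by (simp add: dft_matrix_index[OF N] algebra_simps)
  qed
  then show thesis
    using that f(1) g(1) by blast
qed

section \<open>Vandermonde systems and test vectors\<close>

text \<open>The \<open>w k\<close> are the coefficients of a polynomial of degree below
  \<open>q\<close> that vanishes at \<open>q\<close> distinct points.\<close>

lemma vandermonde_kernel:
  fixes w z :: "nat \<Rightarrow> 'a :: {comm_ring_1, ring_no_zero_divisors}"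
  assumes inj: "inj_on z {..<q}" and zero: "\<And>i. i < q \<Longrightarrow> (\<Sum>k<q. z i ^ k * w k) = 0"
    and k: "k < q"
  shows "w k = 0"
proof -
  define P where "P = (\<Sum>k<q. monom (w k) k)"
  have coeff: "coeff P k = (if k < q then w k else 0)" for k
    by (simp add: P_def coeff_sum sum.delta)
  have "P = 0"
  proof (rule ccontr)
    assume "P \<noteq> 0"
    have "z ` {..<q} \<subseteq> {x. poly P x = 0}"
      using zero by (auto simp: P_def poly_sum poly_monom mult.commute)
    then have "q \<le> card {x. poly P x = 0}"
      using card_mono[OF poly_roots_finite[OF \<open>P \<noteq> 0\<close>]] inj by (metis card_image card_lessThan)
    also have "\<dots> \<le> degree P"
      using \<open>P \<noteq> 0\<close> by (rule card_poly_roots_bound)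
    also have "\<dots> \<le> q - 1"
      by (rule degree_le) (auto simp: coeff)
    finally show False
      using k by simp
  qed
  then show ?thesis
    using coeff[of k] k by simp
qed

text \<open>Norms do not see the order of rows and columns, so computations can use the cyclic
  order.\<close>

lemma permuted_mult_vec:
  assumes A: "A \<in> carrier_mat p q" and v: "v \<in> carrier_vec q"
    and f: "bij_betw f {..<p} {..<p}" and g: "bij_betw g {..<q} {..<q}"
  shows "re_inner (A *\<^sub>v v) (A *\<^sub>v v) =
      (\<Sum>i<p. (cmod (\<Sum>k<q. A $$ (f i, g k) * v $ g k))\<^sup>2)"
    and "re_inner v v = (\<Sum>k<q. (cmod (v $ g k))\<^sup>2)"
proof -
  have "(A *\<^sub>v v) $ f i = (\<Sum>k<q. A $$ (f i, g k) * v $ g k)" if "i < p" for i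
  proof -
    have "f i < p"
      using that f by (auto simp: bij_betw_def)
    then have "(A *\<^sub>v v) $ f i = (\<Sum>l<q. A $$ (f i, l) * v $ l)"
      using A v by (simp add: scalar_prod_def lessThan_atLeast0)
    then show ?thesis
      by (simp add: sum.reindex_bij_betw[OF g, of "\<lambda>l. A $$ (f i, l) * v $ l"])
  qed
  moreover have "re_inner (A *\<^sub>v v) (A *\<^sub>v v) = (\<Sum>i<p. (cmod ((A *\<^sub>v v) $ f i))\<^sup>2)"
    using A v by (subst re_inner_self[of _ p])
      (simp_all add: sum.reindex_bij_betw[OF f, of "\<lambda>i. (cmod ((A *\<^sub>v v) $ i))\<^sup>2"])
  ultimately show "re_inner (A *\<^sub>v v) (A *\<^sub>v v) =
      (\<Sum>i<p. (cmod (\<Sum>k<q. A $$ (f i, g k) * v $ g k))\<^sup>2)"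
    by simp
  show "re_inner v v = (\<Sum>k<q. (cmod (v $ g k))\<^sup>2)"
    using v by (simp add: re_inner_self sum.reindex_bij_betw[OF g, of "\<lambda>k. (cmod (v $ k))\<^sup>2"])
qed

text \<open>The sharper bound, with \<open>n\<close> one less than the number of columns. Both test
  vectors are evaluated through the Vandermonde form of the rows.\<close>

lemma dft_submatrix_condition_number:
  assumes n: "n > 0" and np: "n < p"
    and A: "cyclically_contiguous_submatrix (dft_matrix N) p (Suc n) A"
  shows "(2 * real N / (pi * (real p - 1))) ^ n / sqrt (2 * real n) \<le> condition_number A"
proof -
  let ?q = "Suc n"
  have Ac: "A \<in> carrier_mat p ?q"
    using A by (rule cyclically_contiguous_submatrix_carrier)
  have pN: "p \<le> N"
    using A by (auto simp: cyclically_contiguous_submatrix_def cyclically_consecutive_def dft_matrix_def)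
  then have N: "N > 0" using np by simp
  obtain \<alpha> \<beta> f g where f: "bij_betw f {..<p} {..<p}" and g: "bij_betw g {..<?q} {..<?q}"
    and entry: "\<And>i k. i < p \<Longrightarrow> k < ?q \<Longrightarrow>
      A $$ (f i, g k) = cis (2 * pi * of_int ((\<alpha> + int i) * (\<beta> + int k)) / of_nat N)"
    using dft_submatrix_cyclic_order[OF A N] by metis
  \<comment> \<open>Splitting \<open>(\<alpha> + i) * (\<beta> + k)\<close> writes row
    \<open>i\<close> as the Vandermonde row of the node \<open>z i\<close> times the unimodular
    factor \<open>u i\<close>, which leaves moduli unchanged.\<close>
  define u where "u i = cis (2 * pi * of_int ((\<alpha> + int i) * \<beta>) / of_nat N)" for i
  define z where "z i = cis (2 * pi * of_int (\<alpha> + int i) / of_nat N)" for i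
  have entry': "A $$ (f i, g k) = u i * z i ^ k" if "i < p" "k < ?q" for i k
    using entry[OF that]
    by (simp add: u_def z_def Complex.DeMoivre cis_mult ring_distribs add_divide_distrib mult_ac)
  have Av: "re_inner (A *\<^sub>v v) (A *\<^sub>v v) = (\<Sum>i<p. (cmod (\<Sum>k<?q. z i ^ k * v $ g k))\<^sup>2)"
    if "v \<in> carrier_vec ?q" for v
  proof -
    have "(\<Sum>k<?q. A $$ (f i, g k) * v $ g k) = u i * (\<Sum>k<?q. z i ^ k * v $ g k)" if "i < p" for i
      using entry'[OF that] by (simp add: sum_distrib_left mult.assoc del: sum.lessThan_Suc)
    then show ?thesis
      by (simp add: permuted_mult_vec(1)[OF Ac that f g] norm_mult u_def del: sum.lessThan_Suc)
  qed
  \<comment> \<open>The nodes are distinct \<open>N\<close>-th roots of unity up to a common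
    rotation, because \<open>p\<close> is at most \<open>N\<close>; the first \<open>Suc n\<close>
    rows then form a square Vandermonde system.\<close>
  have inj: "v = 0\<^sub>v ?q" if v: "v \<in> carrier_vec ?q" and Av0: "A *\<^sub>v v = 0\<^sub>v p" for v
  proof -
    have z: "z i = cis (2 * pi * of_int \<alpha> / of_nat N) * cis (2 * pi * real i / real N)" for i
      by (simp add: z_def cis_mult ring_distribs add_divide_distrib)
    have "inj_on (\<lambda>i. cis (2 * pi * real i / real N)) {..<N}"
      using bij_betw_roots_unity[OF N] by (simp add: bij_betw_def)
    then have "inj_on z {..<?q}"
      using np pN by (auto simp: inj_on_def z)
    moreover have "(\<Sum>i<p. (cmod (\<Sum>k<?q. z i ^ k * v $ g k))\<^sup>2) = 0"
      using Av[OF v] by (simp add: Av0 re_inner_def)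
    then have "(\<Sum>k<?q. z i ^ k * v $ g k) = 0" if "i < ?q" for i
      using that np by (subst (asm) sum_nonneg_eq_0_iff) auto
    ultimately have "v $ g k = 0" if "k < ?q" for k
      using vandermonde_kernel[of z ?q "\<lambda>k. v $ g k"] that by blast
    then have "v $ l = 0" if "l < ?q" for l
      using that g by (auto simp: bij_betw_def set_eq_iff image_iff) (metis lessThan_iff)
    then show ?thesis
      using v by (intro eq_vecI) auto
  qed
  \<comment> \<open>The midpoint of the angles of the nodes \<open>z 0\<close>, ...,
    \<open>z (p - 1)\<close>; rotating by \<open>- c\<close> centres them around angle 0.\<close>
  define c where "c = pi * (2 * of_int \<alpha> + (real p - 1)) / real N"
  define w where "w k = of_nat (n choose k) * (- cis (- c)) ^ k" for k
  \<comment> \<open>The inverse of \<open>g\<close> undoes the column permutation, so that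
    \<open>x $ g k = w k\<close>.\<close>
  define x where "x = vec ?q (\<lambda>l. w (inv_into {..<?q} g l))"
  have x: "x \<in> carrier_vec ?q"
    by (simp add: x_def)
  have xg: "x $ g k = w k" if "k < ?q" for k
    using that bij_betw_inv_into_left[OF g, of k] bij_betwE[OF g] by (simp add: x_def)
  have "re_inner x x = (\<Sum>k<?q. (real (n choose k))\<^sup>2)"
    unfolding permuted_mult_vec(2)[OF Ac x f g]
    by (intro sum.cong) (simp_all add: xg w_def norm_mult norm_power)
  also have "\<dots> = real (\<Sum>k\<le>n. (n choose k)\<^sup>2)"
    by (simp add: lessThan_Suc_atMost)
  finally have xx: "4 ^ n / (2 * real n) \<le> re_inner x x"
    using central_binomial_lower_bound[OF n] by (simp only: choose_square_sum)
  have "re_inner x x > 0"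
    by (rule less_le_trans[OF _ xx]) (use n in simp)
  then have x0: "x \<noteq> 0\<^sub>v ?q"
    by (auto simp: re_inner_def)
  define b where "b = (pi * (real p - 1) / real N) ^ n"
  have b: "b > 0"
    using np n N by (simp add: b_def)
  have col: "cmod (\<Sum>k<?q. z i ^ k * x $ g k) \<le> b" if i: "i < p" for i
  proof -
    \<comment> \<open>The angle of node \<open>i\<close> relative to the midpoint \<open>c\<close>;
      its modulus is at most \<open>pi * (p - 1) / N\<close>, since \<open>2 * i\<close> differs
      from \<open>p - 1\<close> by at most \<open>p - 1\<close>.\<close>
    define t where "t = pi * (2 * real i - (real p - 1)) / real N"
    have "2 * pi * of_int (\<alpha> + int i) / real N - c = t"
      by (simp add: c_def t_def algebra_simps flip: diff_divide_distrib)
    then have zt: "z i * cis (- c) = cis t"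
      by (simp add: z_def cis_mult)
    have "(\<Sum>k<?q. z i ^ k * x $ g k) = (\<Sum>k\<le>n. of_nat (n choose k) * (- cis t) ^ k * 1 ^ (n - k))"
      unfolding lessThan_Suc_atMost
      by (intro sum.cong) (simp_all add: xg w_def mult.left_commute flip: power_mult_distrib zt)
    also have "\<dots> = (1 - cis t) ^ n"
      by (subst binomial_ring[symmetric]) simp
    finally have "cmod (\<Sum>k<?q. z i ^ k * x $ g k) = cmod (1 - cis t) ^ n"
      by (simp add: norm_power)
    also have "\<dots> \<le> \<bar>t\<bar> ^ n"
      by (intro power_mono cis_one_minus_bound) simp
    also have "\<bar>t\<bar> = pi * \<bar>2 * real i - (real p - 1)\<bar> / real N"
      by (simp add: t_def abs_mult)
    also have "\<dots> ^ n \<le> b"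
      unfolding b_def using i N np by (intro power_mono divide_right_mono mult_left_mono) auto
    finally show ?thesis .
  qed
  have "re_inner (A *\<^sub>v x) (A *\<^sub>v x) \<le> (\<Sum>i<p. b\<^sup>2)"
    unfolding Av[OF x] using col by (intro sum_mono power_mono) auto
  \<comment> \<open>The factor \<open>4 ^ n / (2 * n)\<close> is split off to be replaced by the
    larger squared norm of \<open>x\<close>.\<close>
  also have "\<dots> = (real p * b\<^sup>2 * (2 * real n) / 4 ^ n) * (4 ^ n / (2 * real n))"
    using n by simp
  also have "\<dots> \<le> (real p * b\<^sup>2 * (2 * real n) / 4 ^ n) * re_inner x x"
    using xx by (intro mult_left_mono) auto
  also have "real p * b\<^sup>2 * (2 * real n) / 4 ^ n = (sqrt p * (b * sqrt (2 * real n) / 2 ^ n))\<^sup>2"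
  proof -
    have "(4 :: real) ^ n = (2 ^ n)\<^sup>2"
      by (simp add: power2_eq_square flip: power_mult_distrib)
    then show ?thesis
      by (simp add: power_mult_distrib power_divide mult_ac)
  qed
  finally have small: "re_inner (A *\<^sub>v x) (A *\<^sub>v x) \<le>
    (sqrt p * (b * sqrt (2 * real n) / 2 ^ n))\<^sup>2 * re_inner x x" .
  \<comment> \<open>The coordinate vector of the first column in cyclic order: that column has
    \<open>p\<close> unimodular entries, so its squared norm is \<open>p\<close>.\<close>
  define y :: "complex vec" where "y = unit_vec ?q (g 0)"
  have g0: "g k < ?q" if "k < ?q" for k
    using g that by (auto simp: bij_betw_def)
  have y: "y \<in> carrier_vec ?q"
    by (simp add: y_def)
  have yg: "y $ g k = (if k = 0 then 1 else 0)" if "k < ?q" for k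
    using g that g0[of k] g0[of 0] by (auto simp: y_def bij_betw_def inj_on_def)
  have y0: "y \<noteq> 0\<^sub>v ?q"
    using yg[of 0] g0[of 0] by auto
  have "re_inner y y = (\<Sum>k<?q. if k = 0 then 1 else 0)"
    unfolding permuted_mult_vec(2)[OF Ac y f g] by (intro sum.cong) (simp_all add: yg)
  then have yy: "re_inner y y = 1"
    by (simp del: sum.lessThan_Suc)
  have "(\<Sum>k<?q. z i ^ k * y $ g k) = (\<Sum>k<?q. if k = 0 then 1 else 0)" for i
    by (intro sum.cong) (simp_all add: yg)
  then have large: "(sqrt p)\<^sup>2 * re_inner y y \<le> re_inner (A *\<^sub>v y) (A *\<^sub>v y)"
    unfolding Av[OF y] by (simp add: yy del: sum.lessThan_Suc)
  have "sqrt p / (sqrt p * (b * sqrt (2 * real n) / 2 ^ n)) \<le> condition_number A"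
    using b np by (intro condition_number_ge[OF Ac _ _ inj x x0 small y y0 large]) auto
  also have "sqrt p / (sqrt p * (b * sqrt (2 * real n) / 2 ^ n)) =
      (2 * real N / (pi * (real p - 1))) ^ n / sqrt (2 * real n)"
    using np by (simp add: b_def power_divide power_mult_distrib)
  finally show ?thesis .
qed

text \<open>Three monotone comparisons reduce the claim to the sharper bound: one each for the
  numerator, the square root and the base of the power.\<close>

theorem theorem3:
  fixes N p q :: nat and A :: "complex mat"
  assumes "1 < q" and "q \<le> p" and "real p < 4 * real N / (exp 1 * pi) + 1"
    and "cyclically_contiguous_submatrix (dft_matrix N) p q A"
  shows "condition_number A \<ge>
    (1 - exp 1 * pi * (real p - 1) / (4 * real N)) / (2 * sqrt (real q)) *
    (4 * real N / (exp 1 * pi * (real p - 1))) ^ (q - 1)"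
proof -
  define n where "n = q - 1"
  have q: "q = Suc n" and n: "n > 0" and np: "n < p"
    using assms(1,2) by (simp_all add: n_def)
  \<comment> \<open>The common scale of the two powers: the claimed base is
    \<open>4 / exp 1 * r\<close>, the available one \<open>2 * r\<close>.\<close>
  define r where "r = real N / (pi * (real p - 1))"
  have r: "r \<ge> 0" using np n by (simp add: r_def)
  have e: "exp (1 :: real) \<ge> 2"
    using exp_ge_add_one_self[of 1] by simp
  have base: "4 / exp 1 * r \<le> 2 * r"
    using e r by (intro mult_right_mono) (auto simp: field_simps)
  have "sqrt (2 * real n) \<le> sqrt (4 * real q)"
    by (simp add: q)
  also have "\<dots> = 2 * sqrt (real q)"
    by (simp add: real_sqrt_mult)
  finally have sqrts: "1 / (2 * sqrt (real q)) \<le> 1 / sqrt (2 * real n)"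
    using n by (intro divide_left_mono) (auto simp: q)
  have "(1 - exp 1 * pi * (real p - 1) / (4 * real N)) / (2 * sqrt (real q)) *
      (4 * real N / (exp 1 * pi * (real p - 1))) ^ (q - 1)
    = (1 - exp 1 * pi * (real p - 1) / (4 * real N)) / (2 * sqrt (real q)) * (4 / exp 1 * r) ^ n"
    by (simp add: n_def r_def mult_ac)
  \<comment> \<open>The term subtracted in the numerator is nonnegative, so the numerator is at most
    1.\<close>
  also have "\<dots> \<le> 1 / (2 * sqrt (real q)) * (4 / exp 1 * r) ^ n"
    using np r by (intro mult_right_mono divide_right_mono) auto
  also have "\<dots> \<le> 1 / sqrt (2 * real n) * (2 * r) ^ n"
    using sqrts r by (intro mult_mono power_mono[OF base]) auto
  also have "\<dots> \<le> condition_number A"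
    using dft_submatrix_condition_number[OF n np] assms(4) by (simp add: q r_def)
  finally show ?thesis .
qed

end
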